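(* Let $(G_i)_{i\ge1}$ be a sequence of distance-regular graphs, $G_i$ having $n_i$ vertices, degree $k_i$, parameters $\lambda_i,\mu_i$ and least adjacency eigenvalue $s_i$, with $n_i\to\infty$ and $|s_i|\mu_i/\lambda_i \to 0$ (i.e. $|s|\mu = o(\lambda)$). Then $G_i$ is asymptotically Delsarte-geometric: there is a sequence $\varepsilon_i\to 0$ such that for all sufficiently large $i$, $G_i$ has a clique geometry all of whose special cliques have order between $(1-\varepsilon_i)k_i/|s_i|$ and $(1+\varepsilon_i)k_i/|s_i|$ (i.e. order $\sim k_i/|s_i|$).
   Context: A connected graph is distance-regular if for any two vertices $u,v$ at distance $i$, the numbers of neighbors of $v$ at distance $i-1$, $i$, and $i+1$ from $u$ depend only on $i$. For a distance-regular graph, $k$ is its degree, $\lambda$ is the number of common neighbors of two adjacent vertices, $\mu$ is the number of common neighbors of two vertices at distance two, and $s$ is the least eigenvalue of its adjacency matrix (so $s<0$). The order of a clique is its number of vertices. A collection $\mathcal{C}$ of cliques of a graph is a clique geometry if (i) every clique in $\mathcal{C}$ is a maximal clique and (ii) every pair of adjacent vertices belongs to exactly one member of $\mathcal{C}$; the members of $\mathcal{C}$ are called special cliques. *)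

theory Defs
  imports Complex_Main "Jordan_Normal_Form.Char_Poly"
begin

definition simple_graph :: "nat \<Rightarrow> (nat \<Rightarrow> nat \<Rightarrow> bool) \<Rightarrow> bool" where
  "simple_graph n E \<longleftrightarrow>
     (\<forall>u v. E u v \<longrightarrow> u < n \<and> v < n) \<and> (\<forall>u v. E u v \<longrightarrow> E v u) \<and> (\<forall>u. \<not> E u u)"

fun walk :: "nat \<Rightarrow> (nat \<Rightarrow> nat \<Rightarrow> bool) \<Rightarrow> nat \<Rightarrow> nat \<Rightarrow> nat \<Rightarrow> bool" where
  "walk n E 0 u v \<longleftrightarrow> u = v"
| "walk n E (Suc m) u v \<longleftrightarrow> (\<exists>w<n. E u w \<and> walk n E m w v)"

definition connected_graph :: "nat \<Rightarrow> (nat \<Rightarrow> nat \<Rightarrow> bool) \<Rightarrow> bool" where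
  "connected_graph n E \<longleftrightarrow> (\<forall>u<n. \<forall>v<n. \<exists>m. walk n E m u v)"

definition gdist :: "nat \<Rightarrow> (nat \<Rightarrow> nat \<Rightarrow> bool) \<Rightarrow> nat \<Rightarrow> nat \<Rightarrow> nat" where
  "gdist n E u v = (LEAST m. walk n E m u v)"

definition neighbors :: "nat \<Rightarrow> (nat \<Rightarrow> nat \<Rightarrow> bool) \<Rightarrow> nat \<Rightarrow> nat set" where
  "neighbors n E v = {w. w < n \<and> E v w}"

definition distance_regular :: "nat \<Rightarrow> (nat \<Rightarrow> nat \<Rightarrow> bool) \<Rightarrow> bool" where
  "distance_regular n E \<longleftrightarrow> simple_graph n E \<and> n > 0 \<and> connected_graph n E \<and>
     (\<forall>u<n. \<forall>v<n. \<forall>u'<n. \<forall>v'<n. gdist n E u v = gdist n E u' v' \<longrightarrow>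
        (\<forall>j\<in>{gdist n E u v - 1, gdist n E u v, gdist n E u v + 1}.
           card {w \<in> neighbors n E v. gdist n E u w = j}
         = card {w \<in> neighbors n E v'. gdist n E u' w = j}))"

definition drg_k :: "nat \<Rightarrow> (nat \<Rightarrow> nat \<Rightarrow> bool) \<Rightarrow> nat" where
  "drg_k n E = card (neighbors n E 0)"

definition drg_lambda :: "nat \<Rightarrow> (nat \<Rightarrow> nat \<Rightarrow> bool) \<Rightarrow> nat" where
  "drg_lambda n E =
     (if \<exists>u v. E u v then
        (let (u, v) = (SOME p. E (fst p) (snd p)) in card (neighbors n E u \<inter> neighbors n E v))
      else 0)"

definition drg_mu :: "nat \<Rightarrow> (nat \<Rightarrow> nat \<Rightarrow> bool) \<Rightarrow> nat" where
  "drg_mu n E =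
     (if \<exists>u<n. \<exists>v<n. gdist n E u v = 2 then
        (let (u, v) = (SOME p. fst p < n \<and> snd p < n \<and> gdist n E (fst p) (snd p) = 2)
         in card (neighbors n E u \<inter> neighbors n E v))
      else 0)"

definition adj_matrix :: "nat \<Rightarrow> (nat \<Rightarrow> nat \<Rightarrow> bool) \<Rightarrow> real mat" where
  "adj_matrix n E = mat n n (\<lambda>(i, j). if E i j then 1 else 0)"

definition least_eig :: "nat \<Rightarrow> (nat \<Rightarrow> nat \<Rightarrow> bool) \<Rightarrow> real" where
  "least_eig n E = Min {s. eigenvalue (adj_matrix n E) s}"

definition is_clique :: "nat \<Rightarrow> (nat \<Rightarrow> nat \<Rightarrow> bool) \<Rightarrow> nat set \<Rightarrow> bool" where
  "is_clique n E C \<longleftrightarrow> C \<subseteq> {..<n} \<and> (\<forall>u\<in>C. \<forall>v\<in>C. u \<noteq> v \<longrightarrow> E u v)"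

definition maximal_clique :: "nat \<Rightarrow> (nat \<Rightarrow> nat \<Rightarrow> bool) \<Rightarrow> nat set \<Rightarrow> bool" where
  "maximal_clique n E C \<longleftrightarrow> is_clique n E C \<and> (\<forall>D. is_clique n E D \<and> C \<subseteq> D \<longrightarrow> D = C)"

definition clique_geometry :: "nat \<Rightarrow> (nat \<Rightarrow> nat \<Rightarrow> bool) \<Rightarrow> nat set set \<Rightarrow> bool" where
  "clique_geometry n E \<C> \<longleftrightarrow> (\<forall>C\<in>\<C>. maximal_clique n E C) \<and>
     (\<forall>u v. E u v \<longrightarrow> (\<exists>!C. C \<in> \<C> \<and> u \<in> C \<and> v \<in> C))"

end

theory Submission
  imports Defs "HOL-Analysis.Function_Topology"
begin

text \<open>
  Put \<open>m = |s|\<close> and \<open>r = m \<mu> / \<lambda>\<close>. Testing the quadratic form of the adjacency matrix on a vector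
  supported on a vertex and its neighbourhood gives \<open>k \<le> m (\<lambda> + m)\<close>; if \<open>\<mu> \<ge> 1\<close>, this yields
  \<open>k \<mu> = O(r \<lambda>\<^sup>2)\<close>. Then all but \<open>O(r \<lambda>)\<close> of the \<open>\<lambda>\<close> common neighbours of the ends of an edge are
  pairwise adjacent, because two of them with many common neighbours cannot be at distance two. So
  every edge lies in a clique of order \<open>(1 - O(r)) \<lambda>\<close>, and the maximal clique of that size is unique,
  because two such cliques on the same edge share more than \<open>\<mu>\<close> vertices. These cliques form a
  geometry with at most \<open>(1 + O(r)) k / \<lambda>\<close> cliques at each vertex, whence
  \<open>m \<le> (1 + O(r)) k / \<lambda>\<close>; with the first inequality this gives \<open>\<lambda> \<sim> k / m\<close>. If \<open>\<mu> = 0\<close>, the graph is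
  complete and the whole vertex set is the only special clique.
\<close>

section \<open>The least eigenvalue as a minimum of the quadratic form\<close>

text \<open>A quadratic in \<open>t\<close> that vanishes at 0 and is nowhere negative has slope 0
  there. This serves as the first-order condition at a minimiser of a quadratic form.\<close>

lemma linear_coeff_zero_if_nonneg:
  fixes b c :: real
  assumes "\<And>t. 0 \<le> 2 * t * b + t\<^sup>2 * c"
  shows "b = 0"
proof (rule ccontr)
  assume "b \<noteq> 0"
  \<comment> \<open>The positive bound \<open>d\<close> replaces \<open>c\<close>, which may be 0 or
    negative. The choice \<open>t = - b / d\<close> minimises the resulting quadratic.\<close>
  define d where "d = \<bar>c\<bar> + 1"
  have "d > 0"
    by (simp add: d_def add_nonneg_pos)
  define t where "t = - b / d"
  have "2 * t * b + t\<^sup>2 * c \<le> 2 * t * b + t\<^sup>2 * d"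
    by (intro add_left_mono mult_left_mono) (auto simp: d_def)
  also have "\<dots> = - (b\<^sup>2 / d)"
    using \<open>d > 0\<close> by (simp add: t_def field_simps power2_eq_square)
  also have "\<dots> < 0"
    using \<open>b \<noteq> 0\<close> \<open>d > 0\<close> by simp
  finally show False
    using assms[of t] by linarith
qed

text \<open>Vectors are encoded as functions vanishing from \<open>n\<close> on. The sphere is a
  closed part of a product of compact sets, \<open>{-1..1}\<close> below \<open>n\<close> and
  \<open>{0}\<close> beyond, so Tychonoff's theorem applies.\<close>

lemma compact_finite_unit_sphere:
  "compact {x :: nat \<Rightarrow> real. (\<forall>i\<ge>n. x i = 0) \<and> (\<Sum>i<n. (x i)\<^sup>2) = 1}" (is "compact ?S")
proof -
  let ?I = "\<lambda>i. if i < n then {-1..1} else {0::real}"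
  have "compactin (product_topology (\<lambda>_. euclidean) UNIV) (PiE UNIV ?I)"
    unfolding compactin_PiE by (auto simp: compactin_euclidean_iff)
  then have K: "compact (PiE UNIV ?I)"
    by (simp add: euclidean_product_topology flip: compactin_euclidean_iff)
  have "closed {x :: nat \<Rightarrow> real. (\<Sum>i<n. (x i)\<^sup>2) = 1}"
    by (intro closed_Collect_eq continuous_intros continuous_on_product_coordinates)
  moreover have "?S = PiE UNIV ?I \<inter> {x. (\<Sum>i<n. (x i)\<^sup>2) = 1}"
  proof (intro Set.set_eqI iffI)
    fix x assume x: "x \<in> ?S"
    have "\<bar>x i\<bar> \<le> 1" if "i < n" for i
    proof -
      have "(x i)\<^sup>2 \<le> (\<Sum>i<n. (x i)\<^sup>2)"
        using that by (intro member_le_sum) auto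
      then show ?thesis
        using x by (simp add: abs_square_le_1)
    qed
    then show "x \<in> PiE UNIV ?I \<inter> {x. (\<Sum>i<n. (x i)\<^sup>2) = 1}"
      using x by (force simp: abs_le_iff)
  next
    fix x assume "x \<in> PiE UNIV ?I \<inter> {x. (\<Sum>i<n. (x i)\<^sup>2) = 1}"
    then have x: "x \<in> PiE UNIV ?I" "(\<Sum>i<n. (x i)\<^sup>2) = 1"
      by blast+
    have "x i = 0" if "i \<ge> n" for i
      using PiE_mem[OF x(1), of i] that by simp
    then show "x \<in> ?S"
      using x(2) by simp
  qed
  ultimately show ?thesis
    using K by (simp add: compact_Int_closed)
qed

text \<open>The form attains its minimum \<open>s\<close> on the unit sphere. Homogeneity extends
  the bound to all vectors, and stationarity makes the minimiser an eigenvector for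
  \<open>s\<close>.\<close>

lemma symmetric_form_min_eigenvector:
  fixes a :: "nat \<Rightarrow> nat \<Rightarrow> real"
  assumes "n > 0" and sym: "\<And>i j. a i j = a j i"
  obtains s y where "\<exists>i<n. y i \<noteq> 0"
    and "\<And>i. i < n \<Longrightarrow> (\<Sum>j<n. a i j * y j) = s * y i"
    and "\<And>x. s * (\<Sum>i<n. (x i)\<^sup>2) \<le> (\<Sum>i<n. x i * (\<Sum>j<n. a i j * x j))"
proof -
  define Q where "Q x = (\<Sum>i<n. x i * (\<Sum>j<n. a i j * x j))" for x :: "nat \<Rightarrow> real"
  define S where "S = {x :: nat \<Rightarrow> real. (\<forall>i\<ge>n. x i = 0) \<and> (\<Sum>i<n. (x i)\<^sup>2) = 1}"
  have "(\<lambda>i. if i = 0 then 1 else 0) \<in> S"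
    using \<open>n > 0\<close> by (simp add: S_def sum.delta if_distrib[of "\<lambda>x. x\<^sup>2"] cong: if_cong)
  moreover have "continuous_on S Q"
    unfolding Q_def
    by (intro continuous_intros continuous_on_subset[OF continuous_on_product_coordinates]) auto
  moreover have "compact S"
    unfolding S_def by (rule compact_finite_unit_sphere)
  ultimately obtain y where y: "y \<in> S" and min: "\<And>x. x \<in> S \<Longrightarrow> Q y \<le> Q x"
    using continuous_attains_inf[of S Q] by blast
  define s where "s = Q y"
  have bound: "s * (\<Sum>i<n. (x i)\<^sup>2) \<le> Q x" for x
  proof (cases "(\<Sum>i<n. (x i)\<^sup>2) = 0")
    case True
    then have "x i = 0" if "i < n" for i
      using that by (simp add: sum_nonneg_eq_0_iff)
    then show ?thesis
      by (simp add: Q_def)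
  next
    case False
    define c where "c = sqrt (\<Sum>i<n. (x i)\<^sup>2)"
    have c2: "c\<^sup>2 = (\<Sum>i<n. (x i)\<^sup>2)"
      by (simp add: c_def sum_nonneg)
    have "c \<noteq> 0"
      using False c2 by auto
    define z where "z i = (if i < n then x i / c else 0)" for i
    have "(\<Sum>i<n. (z i)\<^sup>2) = (\<Sum>i<n. (x i)\<^sup>2) / c\<^sup>2"
      by (simp add: z_def power_divide sum_divide_distrib)
    then have "z \<in> S"
      using \<open>c \<noteq> 0\<close> by (simp add: S_def z_def flip: c2)
    then have "s \<le> Q z"
      using min by (simp add: s_def)
    also have "Q z = Q x / c\<^sup>2"
      by (simp add: Q_def z_def sum_divide_distrib sum_distrib_left power2_eq_square)
    finally show ?thesis
      using \<open>c \<noteq> 0\<close> by (simp add: field_simps flip: c2)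
  qed
  have eig: "(\<Sum>j<n. a i j * y j) = s * y i" if "i < n" for i
  proof -
    define b where "b = (\<Sum>j<n. a i j * y j)"
    \<comment> \<open>The minimiser is moved by \<open>t\<close> in coordinate \<open>i\<close>
      alone. In \<open>bound\<close> for the moved vector the constant terms cancel, since
      \<open>Q y = s\<close> and \<open>y\<close> is a unit vector.\<close>
    have "0 \<le> 2 * t * (b - s * y i) + t\<^sup>2 * (a i i - s)" for t
    proof -
      define e where "e j = (if j = i then t else 0)" for j
      have se: "(\<Sum>j<n. f j * e j) = f i * t" for f
        using \<open>i < n\<close> by (simp add: e_def if_distrib[of "\<lambda>x. _ * x"] sum.delta cong: if_cong)
      have "(\<Sum>j<n. (y j + e j)\<^sup>2) = (\<Sum>j<n. (y j)\<^sup>2) + (\<Sum>j<n. (2 * y j) * e j) + (\<Sum>j<n. e j * e j)"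
        by (simp add: power2_sum power2_eq_square sum.distrib algebra_simps)
      also have "\<dots> = 1 + 2 * t * y i + t\<^sup>2"
        using y unfolding se by (simp add: S_def e_def power2_eq_square)
      finally have norm: "(\<Sum>j<n. (y j + e j)\<^sup>2) = 1 + 2 * t * y i + t\<^sup>2" .
      have row: "(\<Sum>l<n. a j l * (y l + e l)) = (\<Sum>l<n. a j l * y l) + a j i * t" for j
        by (simp add: distrib_left sum.distrib se)
      have "Q (\<lambda>j. y j + e j) = Q y + (\<Sum>j<n. (\<Sum>l<n. a j l * y l) * e j)
          + t * (\<Sum>j<n. a i j * y j) + (\<Sum>j<n. (a j i * t) * e j)"
        unfolding Q_def row
        by (simp add: algebra_simps sum.distrib sum_distrib_left sym[of i])
      also have "\<dots> = s + 2 * t * b + t\<^sup>2 * a i i"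
        unfolding se by (simp add: s_def b_def power2_eq_square)
      finally show ?thesis
        using bound[of "\<lambda>j. y j + e j"] unfolding norm by (simp add: algebra_simps)
    qed
    then have "b - s * y i = 0"
      by (rule linear_coeff_zero_if_nonneg)
    then show ?thesis
      by (simp add: b_def)
  qed
  have "\<exists>i<n. y i \<noteq> 0"
  proof (rule ccontr)
    assume "\<not> ?thesis"
    then have "(\<Sum>i<n. (y i)\<^sup>2) = 0"
      by simp
    then show False
      using y by (simp add: S_def)
  qed
  then show ?thesis
    using that eig bound unfolding Q_def by blast
qed

section \<open>The adjacency matrix and its least eigenvalue\<close>

lemma finite_neighbors [simp]: "finite (neighbors n E v)"
  by (simp add: neighbors_def)

lemma sum_adjacency_row:
  fixes x :: "nat \<Rightarrow> real"
  shows "(\<Sum>j<n. (if E i j then 1 else 0) * x j) = (\<Sum>j\<in>neighbors n E i. x j)"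
proof -
  have "(\<Sum>j<n. (if E i j then 1 else 0) * x j) = (\<Sum>j<n. if E i j then x j else 0)"
    by (intro sum.cong) auto
  also have "\<dots> = (\<Sum>j\<in>neighbors n E i. x j)"
    unfolding neighbors_def by (simp add: sum.inter_filter[symmetric])
  finally show ?thesis .
qed

text \<open>Transfers eigenvectors to plain functions on the vertices, for which the quadratic form
  is set up.\<close>

lemma eigenvalue_adj_matrix_iff:
  "eigenvalue (adj_matrix n E) s \<longleftrightarrow>
     (\<exists>y. (\<exists>i<n. y i \<noteq> 0) \<and> (\<forall>i<n. (\<Sum>j\<in>neighbors n E i. y j) = s * y i))" (is "?L \<longleftrightarrow> ?R")
proof -
  have row: "(adj_matrix n E *\<^sub>v v) $ i = (\<Sum>j\<in>neighbors n E i. v $ j)"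
    if "i < n" "v \<in> carrier_vec n" for v i
    using that
    by (simp add: adj_matrix_def scalar_prod_def lessThan_atLeast0[symmetric] sum_adjacency_row[symmetric])
  have dim: "dim_row (adj_matrix n E) = n"
    by (simp add: adj_matrix_def)
  show ?thesis
  proof
    assume ?L
    then obtain v where v: "v \<in> carrier_vec n" "v \<noteq> 0\<^sub>v n"
        and ev: "adj_matrix n E *\<^sub>v v = s \<cdot>\<^sub>v v"
      by (auto simp: eigenvalue_def eigenvector_def dim)
    have "\<exists>i<n. v $ i \<noteq> 0"
      using v by (metis carrier_vecD eq_vecI index_zero_vec)
    moreover have "(\<Sum>j\<in>neighbors n E i. v $ j) = s * v $ i" if "i < n" for i
      using row[OF that v(1)] that v(1) unfolding ev by simp
    ultimately show ?R
      by (intro exI[of _ "\<lambda>i. v $ i"]) blast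
  next
    assume ?R
    then obtain y i where y: "i < n" "y i \<noteq> 0"
        "\<And>i. i < n \<Longrightarrow> (\<Sum>j\<in>neighbors n E i. y j) = s * y i"
      by blast
    let ?v = "Matrix.vec n y"
    have "(adj_matrix n E *\<^sub>v ?v) $ i = (s \<cdot>\<^sub>v ?v) $ i" if "i < n" for i
    proof -
      have "(\<Sum>j\<in>neighbors n E i. ?v $ j) = (\<Sum>j\<in>neighbors n E i. y j)"
        by (intro sum.cong) (auto simp: neighbors_def)
      then show ?thesis
        using that row[of i ?v] y(3) by simp
    qed
    then have "adj_matrix n E *\<^sub>v ?v = s \<cdot>\<^sub>v ?v"
      by (intro eq_vecI) (auto simp: dim)
    moreover have "?v \<noteq> 0\<^sub>v n"
      using y(1,2) by (metis index_vec index_zero_vec(1))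
    ultimately show ?L
      unfolding eigenvalue_def eigenvector_def dim by (intro exI[of _ ?v]) auto
  qed
qed

text \<open>Eigenvalues are roots of a nonzero characteristic polynomial. Finiteness makes the
  \<open>Min\<close> in \<open>least_eig\<close> a genuine minimum.\<close>

lemma finite_eigenvalues_adj_matrix: "finite {s. eigenvalue (adj_matrix n E) s}"
proof -
  have A: "adj_matrix n E \<in> carrier_mat n n"
    by (simp add: adj_matrix_def)
  have "char_poly (adj_matrix n E) \<noteq> 0"
    using degree_monic_char_poly[OF A] by auto
  then show ?thesis
    using poly_roots_finite by (simp add: eigenvalue_root_char_poly[OF A])
qed

lemma simple_graphD:
  assumes "simple_graph n E"
  shows "E u v \<Longrightarrow> u < n" "E u v \<Longrightarrow> v < n" "E u v \<Longrightarrow> E v u" "\<not> E u u"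
  using assms by (auto simp: simple_graph_def)

text \<open>The minimum \<open>s\<close> of the form on the unit sphere is itself an eigenvalue. So
  the set under \<open>Min\<close> is nonempty and \<open>least_eig n E\<close> is at most
  \<open>s\<close>.\<close>

lemma least_eig_eigenvector_and_le_form:
  assumes G: "simple_graph n E" and "n > 0"
  shows least_eig_eigenvector: "\<exists>y. (\<exists>i<n. y i \<noteq> 0) \<and>
      (\<forall>i<n. (\<Sum>j\<in>neighbors n E i. y j) = least_eig n E * y i)"
    and least_eig_le_form:
      "least_eig n E * (\<Sum>i<n. (x i)\<^sup>2) \<le> (\<Sum>i<n. x i * (\<Sum>j\<in>neighbors n E i. x j))"
proof -
  let ?a = "\<lambda>i j. if E i j then 1 else 0 :: real"
  have sym: "?a i j = ?a j i" for i j
    using simple_graphD(3)[OF G] by auto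
  obtain s y where y: "\<exists>i<n. y i \<noteq> 0"
    and eig: "\<And>i. i < n \<Longrightarrow> (\<Sum>j<n. ?a i j * y j) = s * y i"
    and le: "\<And>x. s * (\<Sum>i<n. (x i)\<^sup>2) \<le> (\<Sum>i<n. x i * (\<Sum>j<n. ?a i j * x j))"
    by (rule symmetric_form_min_eigenvector[of n ?a, OF \<open>n > 0\<close> sym]) (rule that)
  have s: "eigenvalue (adj_matrix n E) s"
    unfolding eigenvalue_adj_matrix_iff using y eig by (auto simp: sum_adjacency_row)
  have "least_eig n E \<in> {s. eigenvalue (adj_matrix n E) s}"
    unfolding least_eig_def using s by (intro Min_in finite_eigenvalues_adj_matrix) auto
  then show "\<exists>y. (\<exists>i<n. y i \<noteq> 0) \<and> (\<forall>i<n. (\<Sum>j\<in>neighbors n E i. y j) = least_eig n E * y i)"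
    by (simp add: eigenvalue_adj_matrix_iff)
  have "least_eig n E \<le> s"
    unfolding least_eig_def using s by (intro Min_le finite_eigenvalues_adj_matrix) auto
  then have "least_eig n E * (\<Sum>i<n. (x i)\<^sup>2) \<le> s * (\<Sum>i<n. (x i)\<^sup>2)"
    by (intro mult_right_mono sum_nonneg) auto
  also have "\<dots> \<le> (\<Sum>i<n. x i * (\<Sum>j\<in>neighbors n E i. x j))"
    using le[of x] by (simp add: sum_adjacency_row)
  finally show "least_eig n E * (\<Sum>i<n. (x i)\<^sup>2) \<le> (\<Sum>i<n. x i * (\<Sum>j\<in>neighbors n E i. x j))" .
qed


section \<open>Bounds on the least eigenvalue\<close>

lemma least_eig_le_minus_one:
  assumes G: "simple_graph n E" and "E u v"
  shows "least_eig n E \<le> - 1"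
proof -
  note g = simple_graphD[OF G]
  have uv: "u < n" "v < n" "u \<noteq> v"
    using g \<open>E u v\<close> by blast+
  \<comment> \<open>The difference of the indicators of the two ends of an edge has squared norm 2
    and form value -2.\<close>
  define x :: "nat \<Rightarrow> real" where "x i = (if i = u then 1 else 0) - (if i = v then 1 else 0)" for i
  have row: "(\<Sum>j\<in>neighbors n E i. x j) = (if E i u then 1 else 0) - (if E i v then 1 else 0)" for i
    using uv by (simp add: x_def sum_subtractf sum.delta) (simp add: neighbors_def)
  have zero: "x i = 0" if "i \<notin> {u, v}" for i
    using that by (simp add: x_def)
  have "(\<Sum>i<n. (x i)\<^sup>2) = (\<Sum>i\<in>{u, v}. (x i)\<^sup>2)"
    by (rule sum.mono_neutral_right) (use uv zero in auto)
  also have "\<dots> = 2"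
    using uv by (simp add: x_def)
  finally have norm: "(\<Sum>i<n. (x i)\<^sup>2) = 2" .
  have "(\<Sum>i<n. x i * (\<Sum>j\<in>neighbors n E i. x j)) = (\<Sum>i\<in>{u, v}. x i * (\<Sum>j\<in>neighbors n E i. x j))"
    by (rule sum.mono_neutral_right) (use uv zero in auto)
  also have "\<dots> = - 2"
    using uv g(3,4) \<open>E u v\<close> by (simp add: row) (simp add: x_def)
  finally show ?thesis
    using least_eig_le_form[OF G, of x] uv norm by simp
qed

text \<open>The test vector is supported on a vertex and its neighbourhood; the value at the centre is the
  one minimising the form.\<close>

lemma degree_le_least_eig:
  assumes G: "simple_graph n E" and "E v u" and deg: "card (neighbors n E v) = k"
    and lam: "\<And>w. E v w \<Longrightarrow> card (neighbors n E v \<inter> neighbors n E w) = l"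
  shows "real k \<le> \<bar>least_eig n E\<bar> * (real l + \<bar>least_eig n E\<bar>)"
proof -
  note g = simple_graphD[OF G]
  have vn: "v < n"
    using g \<open>E v u\<close> by blast
  define m where "m = \<bar>least_eig n E\<bar>"
  have s: "least_eig n E = - m" and "m > 0"
    using least_eig_le_minus_one[OF G \<open>E v u\<close>] by (auto simp: m_def)
  define N where "N = neighbors n E v"
  have Nn: "N \<subseteq> {..<n}" "v \<notin> N"
    using g by (auto simp: N_def neighbors_def)
  have finN: "finite N"
    by (simp add: N_def)
  define c where "c = - (real k / m)"
  define x :: "nat \<Rightarrow> real" where "x i = (if i = v then c else 0) + (if i \<in> N then 1 else 0)" for i
  have row: "(\<Sum>j\<in>neighbors n E i. x j) = (if E i v then c else 0) + card (N \<inter> neighbors n E i)" for i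
  proof -
    have "(\<Sum>j\<in>neighbors n E i. if j \<in> N then 1 else 0 :: real) = card (N \<inter> neighbors n E i)"
      by (simp add: sum.If_cases Int_commute)
    moreover have "(\<Sum>j\<in>neighbors n E i. if j = v then c else 0) = (if E i v then c else 0)"
      using vn by (simp add: sum.delta) (simp add: neighbors_def)
    ultimately show ?thesis
      by (simp add: x_def sum.distrib)
  qed
  have zero: "x i = 0" if "i \<notin> insert v N" for i
    using that by (simp add: x_def)
  have xv: "x v = c" and xN: "\<And>i. i \<in> N \<Longrightarrow> x i = 1"
    using Nn by (auto simp: x_def)
  have "(\<Sum>i<n. (x i)\<^sup>2) = (\<Sum>i\<in>insert v N. (x i)\<^sup>2)"
    by (rule sum.mono_neutral_right) (use vn Nn zero in auto)
  also have "\<dots> = c\<^sup>2 + k"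
    using Nn finN deg by (simp add: xv xN N_def)
  finally have norm: "(\<Sum>i<n. (x i)\<^sup>2) = c\<^sup>2 + k" .
  have "(\<Sum>i<n. x i * (\<Sum>j\<in>neighbors n E i. x j)) = (\<Sum>i\<in>insert v N. x i * (\<Sum>j\<in>neighbors n E i. x j))"
    by (rule sum.mono_neutral_right) (use vn Nn zero in auto)
  \<comment> \<open>The centre sees its \<open>k\<close> neighbours, each of weight 1; a neighbour
    sees the centre, of weight \<open>c\<close>, and \<open>l\<close> further vertices of
    \<open>N\<close>.\<close>
  also have "\<dots> = c * k + (\<Sum>i\<in>N. c + l)"
  proof -
    have "x v * (\<Sum>j\<in>neighbors n E v. x j) = c * k"
      using g deg by (simp add: row xv N_def)
    moreover have "x i * (\<Sum>j\<in>neighbors n E i. x j) = c + l" if "i \<in> N" for i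
      using that lam g(3) by (simp add: row xN) (auto simp: N_def neighbors_def)
    ultimately show ?thesis
      using finN Nn by simp
  qed
  also have "\<dots> = 2 * c * k + k * l"
    using deg by (simp add: N_def algebra_simps)
  finally have "- m * (c\<^sup>2 + k) \<le> 2 * c * k + k * l"
    using least_eig_le_form[OF G, of x] vn norm s by simp
  moreover have "m * c\<^sup>2 = real k * (k / m)" "c * k = - (real k * (k / m))"
    using \<open>m > 0\<close> by (simp_all add: c_def power2_eq_square)
  ultimately have "real k * (k / m) \<le> k * (l + m)"
    by (simp add: algebra_simps)
  moreover have "k > 0"
    using deg \<open>E v u\<close> g(2)[OF \<open>E v u\<close>] by (auto simp: card_gt_0_iff neighbors_def)
  ultimately have "k / m \<le> l + m"
    by (metis mult_le_cancel_left_pos of_nat_0_less_iff)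
  then show ?thesis
    using \<open>m > 0\<close> by (simp add: m_def field_simps)
qed

text \<open>If \<open>N\<close> is the vertex-clique incidence matrix and \<open>D\<close> the diagonal matrix counting the special
  cliques at each vertex, then \<open>N N\<^sup>T = A + D\<close> is positive semidefinite.\<close>

lemma least_eig_ge_clique_geometry:
  fixes d :: real
  assumes G: "simple_graph n E" and "n > 0" and geo: "clique_geometry n E \<C>"
    and d: "\<And>v. v < n \<Longrightarrow> real (card {C \<in> \<C>. v \<in> C}) \<le> d"
  shows "- least_eig n E \<le> d"
proof -
  note g = simple_graphD[OF G]
  let ?s = "least_eig n E"
  obtain y where y0: "\<exists>i<n. y i \<noteq> 0"
      and eig: "\<And>i. i < n \<Longrightarrow> (\<Sum>j\<in>neighbors n E i. y j) = ?s * y i"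
    using least_eig_eigenvector[OF G \<open>n > 0\<close>] by blast
  have clq: "C \<subseteq> {..<n}" "\<And>u v. u \<in> C \<Longrightarrow> v \<in> C \<Longrightarrow> u \<noteq> v \<Longrightarrow> E u v" if "C \<in> \<C>" for C
    using geo that by (auto simp: clique_geometry_def maximal_clique_def is_clique_def)
  have "finite \<C>"
    by (rule finite_subset[of _ "Pow {..<n}"]) (use clq in auto)
  \<comment> \<open>These are the entries of \<open>A + D\<close>: an edge lies in exactly one
    special clique, and two distinct non-adjacent vertices lie in none.\<close>
  have cnt: "real (card {C \<in> \<C>. i \<in> C \<and> j \<in> C})
      = (if E i j then 1 else 0) + (if j = i then real (card {C \<in> \<C>. i \<in> C}) else 0)" for i j
  proof -
    consider "i = j" | "E i j" | "i \<noteq> j" "\<not> E i j"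
      by blast
    then show ?thesis
    proof cases
      case 2
      then have "\<exists>!C. C \<in> \<C> \<and> i \<in> C \<and> j \<in> C"
        using geo by (simp add: clique_geometry_def)
      then obtain C where "{C \<in> \<C>. i \<in> C \<and> j \<in> C} = {C}"
        by (auto simp: card_1_singleton_iff elim!: ex1E)
      then show ?thesis
        using 2 g(4) by auto
    next
      case 3
      then have none: "{C \<in> \<C>. i \<in> C \<and> j \<in> C} = {}"
        using clq by blast
      show ?thesis
        unfolding none using 3 by simp
    qed (use g in auto)
  qed
  define z :: "nat set \<Rightarrow> nat \<Rightarrow> real" where "z C i = (if i \<in> C then 1 else 0)" for C i
  \<comment> \<open>The sum is the squared norm of the transposed incidence matrix applied to
    \<open>y\<close>. It is expanded to the form of \<open>A + D\<close> at \<open>y\<close>, where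
    \<open>A\<close> acts as the scalar \<open>?s\<close>.\<close>
  have "0 \<le> (\<Sum>C\<in>\<C>. (\<Sum>i<n. z C i * y i)\<^sup>2)"
    by (intro sum_nonneg) auto
  also have "\<dots> = (\<Sum>C\<in>\<C>. \<Sum>i<n. \<Sum>j<n. z C i * z C j * (y i * y j))"
    by (simp add: power2_eq_square sum_product ac_simps)
  also have "\<dots> = (\<Sum>i<n. \<Sum>C\<in>\<C>. \<Sum>j<n. z C i * z C j * (y i * y j))"
    by (rule sum.swap)
  also have "\<dots> = (\<Sum>i<n. \<Sum>j<n. \<Sum>C\<in>\<C>. z C i * z C j * (y i * y j))"
    by (intro sum.cong refl sum.swap)
  also have "\<dots> = (\<Sum>i<n. \<Sum>j<n. real (card {C \<in> \<C>. i \<in> C \<and> j \<in> C}) * (y i * y j))"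
  proof (intro sum.cong refl)
    fix i j
    have "(\<Sum>C\<in>\<C>. z C i * z C j) = (\<Sum>C\<in>\<C>. if i \<in> C \<and> j \<in> C then 1 else 0)"
      by (intro sum.cong) (auto simp: z_def)
    also have "\<dots> = real (card {C \<in> \<C>. i \<in> C \<and> j \<in> C})"
      using \<open>finite \<C>\<close> by (simp flip: sum.inter_filter)
    finally show "(\<Sum>C\<in>\<C>. z C i * z C j * (y i * y j)) = real (card {C \<in> \<C>. i \<in> C \<and> j \<in> C}) * (y i * y j)"
      by (simp flip: sum_distrib_right)
  qed
  also have "\<dots> = (\<Sum>i<n. (?s + real (card {C \<in> \<C>. i \<in> C})) * (y i)\<^sup>2)"
  proof (intro sum.cong refl)
    fix i assume "i \<in> {..<n}"
    then have i: "i < n" by simp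
    let ?D = "real (card {C \<in> \<C>. i \<in> C})"
    have "(\<Sum>j<n. real (card {C \<in> \<C>. i \<in> C \<and> j \<in> C}) * (y i * y j))
        = y i * (\<Sum>j<n. (if E i j then 1 else 0) * y j) + (\<Sum>j<n. if j = i then ?D * (y i)\<^sup>2 else 0)"
      unfolding cnt sum_distrib_left sum.distrib[symmetric]
      by (intro sum.cong) (auto simp: algebra_simps power2_eq_square)
    also have "\<dots> = (?s + ?D) * (y i)\<^sup>2"
      unfolding sum_adjacency_row eig[OF i] using i by (simp add: sum.delta power2_eq_square algebra_simps)
    finally show "(\<Sum>j<n. real (card {C \<in> \<C>. i \<in> C \<and> j \<in> C}) * (y i * y j)) = (?s + ?D) * (y i)\<^sup>2" .
  qed
  also have "\<dots> \<le> (\<Sum>i<n. (?s + d) * (y i)\<^sup>2)"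
    using d by (intro sum_mono mult_right_mono) auto
  also have "\<dots> = (?s + d) * (\<Sum>i<n. (y i)\<^sup>2)"
    by (simp add: sum_distrib_left)
  finally have "0 \<le> (?s + d) * (\<Sum>i<n. (y i)\<^sup>2)" .
  moreover have "(\<Sum>i<n. (y i)\<^sup>2) > 0"
    using y0 by (auto intro!: sum_pos2)
  ultimately show ?thesis
    by (simp add: zero_le_mult_iff)
qed


section \<open>Metsch's clique geometry\<close>

lemma maximal_clique_extension:
  assumes "is_clique n E K"
  obtains M where "K \<subseteq> M" "maximal_clique n E M"
proof -
  have "finite {D. is_clique n E D}"
    by (rule finite_subset[of _ "Pow {..<n}"]) (auto simp: is_clique_def)
  from finite_has_maximal2[OF this, of K] obtain M
    where "is_clique n E M" "K \<subseteq> M" "\<forall>D. is_clique n E D \<longrightarrow> M \<subseteq> D \<longrightarrow> M = D"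
    using assms by auto
  then show ?thesis
    using that[of M] by (auto simp: maximal_clique_def)
qed

text \<open>An upper bound in \<open>mu\<close>, rather than an equality, also covers vertices at
  distance greater than two, which have no common neighbour.\<close>

locale bounded_mu_graph =
  fixes n :: nat and E :: "nat \<Rightarrow> nat \<Rightarrow> bool" and k l \<mu> :: nat
  assumes G: "simple_graph n E"
    and deg: "\<And>v. v < n \<Longrightarrow> card (neighbors n E v) = k"
    and lam: "\<And>u v. E u v \<Longrightarrow> card (neighbors n E u \<inter> neighbors n E v) = l"
    and mu: "\<And>u v. u < n \<Longrightarrow> v < n \<Longrightarrow> u \<noteq> v \<Longrightarrow> \<not> E u v \<Longrightarrow>
      card (neighbors n E u \<inter> neighbors n E v) \<le> \<mu>"
begin

abbreviation N :: "nat \<Rightarrow> nat set" where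
  "N \<equiv> neighbors n E"

lemmas g = simple_graphD[OF G]

lemma in_neighbors_iff: "w \<in> N v \<longleftrightarrow> E v w"
  using g by (auto simp: neighbors_def)

text \<open>A vertex \<open>z\<close> adjacent to \<open>v\<close> but not to \<open>x\<close> has at most \<open>\<mu>\<close> neighbours in the set \<open>W\<close> of
  common neighbours of \<open>v\<close> and \<open>x\<close>. Hence at most \<open>k \<mu>\<close> edges join \<open>W\<close> to such vertices, and \<open>W\<close>,
  whose vertices all have degree \<open>l\<close> in the neighbourhood of \<open>v\<close>, is almost a clique.\<close>

lemma edge_in_large_clique:
  assumes vx: "E v x" and large: "2 * \<mu> + 4 < l"
  obtains K where "is_clique n E K" "v \<in> K" "x \<in> K"
    "real l + 2 - 4 * real k * real \<mu> / real l \<le> real (card K)"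
proof -
  have xv: "E x v" "v \<noteq> x" and vn: "v < n" "x < n"
    using g vx by blast+
  define W where "W = N v \<inter> N x"
  define Z where "Z = {z \<in> N v. z \<noteq> x \<and> \<not> E x z}"
  define f where "f y = card (Z \<inter> N y)" for y
  have fin: "finite W" "finite Z"
    by (auto simp: W_def Z_def)
  have W: "card W = l"
    using lam[OF vx] by (simp add: W_def)
  \<comment> \<open>Inside \<open>N v\<close>, the \<open>l\<close> neighbours of \<open>y\<close>
    are \<open>x\<close> itself, those adjacent to \<open>x\<close> (in \<open>W\<close>) and those
    not (in \<open>Z\<close>).\<close>
  have deg_W: "card (W \<inter> N y) + f y + 1 = l" if "y \<in> W" for y
  proof -
    have "N v \<inter> N y = insert x ((W \<inter> N y) \<union> (Z \<inter> N y))"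
      using that vx xv g by (auto simp: W_def Z_def in_neighbors_iff)
    moreover have "x \<notin> (W \<inter> N y) \<union> (Z \<inter> N y)"
      using g by (auto simp: W_def Z_def in_neighbors_iff)
    moreover have "(W \<inter> N y) \<inter> (Z \<inter> N y) = {}"
      by (auto simp: W_def Z_def in_neighbors_iff)
    moreover have "card (N v \<inter> N y) = l"
      using that lam by (simp add: W_def in_neighbors_iff)
    ultimately show ?thesis
      using fin by (simp add: f_def card_Un_disjoint)
  qed
  have sum_f: "(\<Sum>y\<in>W. f y) \<le> k * \<mu>"
  proof -
    have "(\<Sum>y\<in>W. f y) = (\<Sum>y\<in>W. \<Sum>z\<in>Z. if E y z then 1 else 0)"
      using fin by (simp add: f_def sum.If_cases in_neighbors_iff Int_def)
    also have "\<dots> = (\<Sum>z\<in>Z. \<Sum>y\<in>W. if E y z then 1 else 0)"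
      by (rule sum.swap)
    also have "\<dots> = (\<Sum>z\<in>Z. card (W \<inter> N z))"
      using fin g(3) by (intro sum.cong refl) (auto simp: sum.If_cases in_neighbors_iff intro!: arg_cong[of _ _ card])
    also have "\<dots> \<le> (\<Sum>z\<in>Z. \<mu>)"
    proof (rule sum_mono)
      fix z assume z: "z \<in> Z"
      have "card (W \<inter> N z) \<le> card (N x \<inter> N z)"
        by (intro card_mono) (auto simp: W_def)
      also have "\<dots> \<le> \<mu>"
        using z vn g by (intro mu) (auto simp: Z_def in_neighbors_iff)
      finally show "card (W \<inter> N z) \<le> \<mu>" .
    qed
    also have "\<dots> = card Z * \<mu>"
      by simp
    also have "card Z \<le> card (N v)"
      by (intro card_mono) (auto simp: Z_def)
    finally show ?thesis
      using deg[OF vn(1)] by simp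
  qed
  \<comment> \<open>Two good vertices each have more than \<open>3 * l / 4 - 1\<close> neighbours in
    \<open>W\<close>, so they share more than \<open>l / 2 - 2\<close>. By \<open>large\<close> this
    exceeds \<open>\<mu>\<close>, which forces adjacency.\<close>
  define Good where "Good = {y \<in> W. 4 * f y < l}"
  define Bad where "Bad = {y \<in> W. l \<le> 4 * f y}"
  have "W = Good \<union> Bad" "Good \<inter> Bad = {}" "finite Good" "finite Bad"
    using fin by (auto simp: Good_def Bad_def)
  then have card_W: "l = card Good + card Bad"
    using W by (metis card_Un_disjoint)
  \<comment> \<open>Markov's inequality: few vertices can have \<open>f\<close> at least
    \<open>l / 4\<close>, because the sum of \<open>f\<close> over \<open>W\<close> is at most
    \<open>k * \<mu>\<close>.\<close>
  have "card Bad * l = (\<Sum>y\<in>Bad. l)"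
    by simp
  also have "\<dots> \<le> (\<Sum>y\<in>Bad. 4 * f y)"
    by (intro sum_mono) (simp add: Bad_def)
  also have "\<dots> \<le> (\<Sum>y\<in>W. 4 * f y)"
    using fin by (intro sum_mono2) (auto simp: Bad_def)
  also have "\<dots> \<le> 4 * (k * \<mu>)"
    using sum_f by (simp flip: sum_distrib_left)
  finally have "real (card Bad) * real l \<le> 4 * real k * real \<mu>"
    by (metis (mono_tags, lifting) mult.assoc of_nat_le_iff of_nat_mult of_nat_numeral)
  then have Bad: "real (card Bad) \<le> 4 * real k * real \<mu> / real l"
    using large by (simp add: field_simps)
  have Good_clique: "E y z" if y: "y \<in> Good" and z: "z \<in> Good" and "y \<noteq> z" for y z
  proof (rule ccontr)
    assume "\<not> E y z"
    moreover have "y < n" "z < n"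
      using y z by (auto simp: Good_def W_def neighbors_def)
    ultimately have "card (N y \<inter> N z) \<le> \<mu>"
      using mu \<open>y \<noteq> z\<close> by blast
    moreover have "card ((W \<inter> N y) \<inter> (W \<inter> N z)) \<le> card (N y \<inter> N z)"
      by (intro card_mono) auto
    moreover have "card ((W \<inter> N y) \<union> (W \<inter> N z)) \<le> l"
      using fin unfolding W[symmetric] by (intro card_mono) auto
    moreover have "card (W \<inter> N y) + card (W \<inter> N z)
        = card ((W \<inter> N y) \<union> (W \<inter> N z)) + card ((W \<inter> N y) \<inter> (W \<inter> N z))"
      using fin by (intro card_Un_Int) auto
    moreover have "card (W \<inter> N y) + f y + 1 = l" "card (W \<inter> N z) + f z + 1 = l"
        "4 * f y < l" "4 * f z < l"
      using y z deg_W by (auto simp: Good_def)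
    ultimately show False
      using large by linarith
  qed
  let ?K = "insert v (insert x Good)"
  have "is_clique n E ?K"
    unfolding is_clique_def
  proof (intro conjI ballI impI)
    have edges: "E v y" "E x y" if "y \<in> Good" for y
      using that by (auto simp: Good_def W_def in_neighbors_iff)
    show "?K \<subseteq> {..<n}"
      using vn edges g(2) by auto
    fix y z assume "y \<in> ?K" "z \<in> ?K" "y \<noteq> z"
    then show "E y z"
      using Good_clique[of y z] vx xv edges[of y] edges[of z] g(3)[of _ y] by auto
  qed
  moreover have "card ?K = card Good + 2"
    using \<open>finite Good\<close> xv g by (simp add: Good_def W_def in_neighbors_iff)
  then have "real l + 2 - 4 * real k * real \<mu> / real l \<le> real (card ?K)"
    using Bad card_W by simp
  ultimately show ?thesis
    using that by blast
qed

section \<open>Uniqueness of large cliques and the geometry they form\<close>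

lemma clique_subset_closed_edge:
  assumes "is_clique n E C" "u \<in> C" "v \<in> C"
  shows "C \<subseteq> insert u (insert v (N u \<inter> N v))"
  using assms by (auto simp: is_clique_def in_neighbors_iff)

lemma card_closed_edge_le:
  assumes "E u v"
  shows "card (insert u (insert v (N u \<inter> N v))) \<le> l + 2"
  using lam[OF assms] assms g(4)[of u] by (auto simp: card_insert_if)

text \<open>Both cliques lie in a set of \<open>l + 2\<close> vertices, so they share at least
  \<open>l / 2 - 2\<close> vertices, more than \<open>\<mu>\<close>. Hence no vertex of one can be
  non-adjacent to a different vertex of the other; the union is a clique, and maximality gives
  equality.\<close>

lemma large_maximal_cliques_eq:
  assumes M: "maximal_clique n E M" "3 * l \<le> 4 * card M"
    and M': "maximal_clique n E M'" "3 * l \<le> 4 * card M'"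
    and edge: "E u v" "u \<in> M" "v \<in> M" "u \<in> M'" "v \<in> M'"
    and large: "2 * \<mu> + 4 < l"
  shows "M = M'"
proof -
  have c: "is_clique n E M" "is_clique n E M'"
    using M M' by (auto simp: maximal_clique_def)
  then have fin: "finite M" "finite M'"
    by (auto simp: is_clique_def intro: finite_subset)
  have "card (M \<union> M') \<le> card (insert u (insert v (N u \<inter> N v)))"
    using c edge by (intro card_mono Un_least clique_subset_closed_edge) auto
  also have "\<dots> \<le> l + 2"
    using edge(1) by (rule card_closed_edge_le)
  finally have inter: "\<mu> < card (M \<inter> M')"
    using card_Un_Int[OF fin] M(2) M'(2) large by linarith
  have "E y z" if "y \<in> M" "z \<in> M'" "y \<noteq> z" for y z
  proof (rule ccontr)
    assume "\<not> E y z"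
    \<comment> \<open>Neither \<open>y\<close> nor \<open>z\<close> lies in both cliques, since
      otherwise \<open>y\<close> and \<open>z\<close> would share a clique and be adjacent.\<close>
    then have "M \<inter> M' \<subseteq> N y \<inter> N z"
      using c that g(3)[of y z] unfolding is_clique_def in_neighbors_iff subset_iff Int_iff
      by (metis g(3))
    then have "card (M \<inter> M') \<le> card (N y \<inter> N z)"
      by (intro card_mono) auto
    also have "\<dots> \<le> \<mu>"
      using c that \<open>\<not> E y z\<close> by (intro mu) (auto simp: is_clique_def)
    finally show False
      using inter by simp
  qed
  then have "is_clique n E (M \<union> M')"
    using c g(3) unfolding is_clique_def by (metis Un_iff Un_least)
  then show ?thesis
    using M(1) M'(1) unfolding maximal_clique_def by (metis Un_upper1 Un_upper2)
qed

text \<open>The threshold \<open>3 * l / 4\<close> is low enough for every edge to reach it when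
  \<open>k * \<mu>\<close> is small, and high enough for two such cliques on one edge to
  coincide.\<close>

definition special_cliques :: "nat set set" where
  "special_cliques = {M. maximal_clique n E M \<and> 3 * l \<le> 4 * card M}"

context
  assumes large: "2 * \<mu> + 4 < l" and small: "16 * real k * real \<mu> \<le> (real l)\<^sup>2"
begin

lemma edge_in_special_clique:
  assumes "E u v"
  obtains M where "M \<in> special_cliques" "u \<in> M" "v \<in> M"
    "real l + 2 - 4 * real k * real \<mu> / real l \<le> real (card M)"
proof -
  obtain K where K: "is_clique n E K" "u \<in> K" "v \<in> K"
      and cK: "real l + 2 - 4 * real k * real \<mu> / real l \<le> real (card K)"
    using edge_in_large_clique[OF assms large] by blast
  obtain M where M: "K \<subseteq> M" "maximal_clique n E M"
    using maximal_clique_extension[OF K(1)] by blast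
  have "finite M"
    using M(2) by (auto simp: maximal_clique_def is_clique_def intro: finite_subset)
  then have "card K \<le> card M"
    using M(1) by (simp add: card_mono)
  then have cM: "real l + 2 - 4 * real k * real \<mu> / real l \<le> real (card M)"
    using cK by linarith
  have "4 * real k * real \<mu> / real l \<le> real l / 4"
    using small large by (simp add: field_simps power2_eq_square)
  then have "3 * real l \<le> 4 * real (card M)"
    using cM by linarith
  then have "3 * l \<le> 4 * card M"
    by linarith
  then show ?thesis
    using that[of M] M K cM by (auto simp: special_cliques_def)
qed

lemma special_cliques_unique:
  assumes "M \<in> special_cliques" "M' \<in> special_cliques" "E u v" "u \<in> M" "v \<in> M" "u \<in> M'" "v \<in> M'"
  shows "M = M'"
  using assms large large_maximal_cliques_eq[of M M' u v] by (simp add: special_cliques_def)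

lemma clique_geometry_special_cliques: "clique_geometry n E special_cliques"
  unfolding clique_geometry_def
proof (intro conjI ballI allI impI)
  fix u v assume "E u v"
  then show "\<exists>!C. C \<in> special_cliques \<and> u \<in> C \<and> v \<in> C"
    using special_cliques_unique[OF _ _ \<open>E u v\<close>] by (elim edge_in_special_clique) blast
qed (simp add: special_cliques_def)

text \<open>A special clique contains an edge, so by uniqueness it is the clique constructed for
  that edge. This improves the threshold \<open>3 * l / 4\<close> to the sharper lower
  bound.\<close>

lemma card_special_clique:
  assumes "C \<in> special_cliques"
  shows "real l + 2 - 4 * real k * real \<mu> / real l \<le> real (card C)" and "card C \<le> l + 2"
proof -
  have C: "is_clique n E C" "3 * l \<le> 4 * card C"
    using assms by (auto simp: special_cliques_def maximal_clique_def)
  then have "\<not> card C \<le> Suc 0"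
    using large by linarith
  moreover have "finite C"
    using C(1) by (auto simp: is_clique_def intro: finite_subset)
  ultimately obtain u v where uv: "u \<in> C" "v \<in> C" "u \<noteq> v"
    by (auto simp: card_le_Suc0_iff_eq)
  then have "E u v"
    using C(1) by (simp add: is_clique_def)
  obtain M where "M \<in> special_cliques" "u \<in> M" "v \<in> M"
      "real l + 2 - 4 * real k * real \<mu> / real l \<le> real (card M)"
    using edge_in_special_clique[OF \<open>E u v\<close>] by blast
  moreover from this have "M = C"
    using assms special_cliques_unique \<open>E u v\<close> uv by blast
  ultimately show "real l + 2 - 4 * real k * real \<mu> / real l \<le> real (card C)"
    by simp
  have "card C \<le> card (insert u (insert v (N u \<inter> N v)))"
    using C uv by (intro card_mono clique_subset_closed_edge) auto
  also have "\<dots> \<le> l + 2"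
    using \<open>E u v\<close> by (rule card_closed_edge_le)
  finally show "card C \<le> l + 2" .
qed

text \<open>Distinct special cliques through \<open>v\<close> meet only in \<open>v\<close>, so
  without \<open>v\<close> they are disjoint subsets of the \<open>k\<close> neighbours.\<close>

lemma card_special_cliques_at_vertex:
  assumes "v < n"
  shows "real (card {C \<in> special_cliques. v \<in> C}) * (real l + 1 - 4 * real k * real \<mu> / real l) \<le> real k"
proof -
  let ?S = "{C \<in> special_cliques. v \<in> C}"
  have clq: "is_clique n E C" if "C \<in> special_cliques" for C
    using that by (simp add: special_cliques_def maximal_clique_def)
  then have fin: "finite C" if "C \<in> special_cliques" for C
    using that by (auto simp: is_clique_def intro: finite_subset)
  have finS: "finite ?S"
    by (rule finite_subset[of _ "Pow {..<n}"]) (use clq in \<open>auto simp: is_clique_def\<close>)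
  have "real (card ?S) * (real l + 1 - 4 * real k * real \<mu> / real l)
      = (\<Sum>C\<in>?S. real l + 1 - 4 * real k * real \<mu> / real l)"
    by simp
  also have "\<dots> \<le> (\<Sum>C\<in>?S. real (card (C - {v})))"
  proof (rule sum_mono)
    fix C assume C: "C \<in> ?S"
    then have "card C = Suc (card (C - {v}))"
      using fin[of C] by (intro card.remove) auto
    then show "real l + 1 - 4 * real k * real \<mu> / real l \<le> real (card (C - {v}))"
      using card_special_clique(1)[of C] C by simp
  qed
  also have "\<dots> = real (card (\<Union>C\<in>?S. C - {v}))"
  proof -
    have "card (\<Union>C\<in>?S. C - {v}) = (\<Sum>C\<in>?S. card (C - {v}))"
    proof (rule card_UN_disjoint)
      show "\<forall>C\<in>?S. \<forall>D\<in>?S. C \<noteq> D \<longrightarrow> (C - {v}) \<inter> (D - {v}) = {}"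
      proof (intro ballI impI)
        fix C D assume CD: "C \<in> ?S" "D \<in> ?S" "C \<noteq> D"
        have "w \<notin> D" if "w \<in> C" "w \<noteq> v" for w
        proof
          assume "w \<in> D"
          moreover have "E v w"
            using CD(1) clq[of C] that by (auto simp: is_clique_def)
          ultimately show False
            using CD that special_cliques_unique[of C D v w] by auto
        qed
        then show "(C - {v}) \<inter> (D - {v}) = {}"
          by auto
      qed
    qed (use fin finS in auto)
    then show ?thesis
      by simp
  qed
  also have "\<dots> \<le> real (card (N v))"
  proof -
    have "E v w" if "C \<in> ?S" "w \<in> C - {v}" for C w
      using that clq[of C] by (auto simp: is_clique_def)
    then have "(\<Union>C\<in>?S. C - {v}) \<subseteq> N v"
      by (intro UN_least subsetI) (simp only: in_neighbors_iff)
    then show ?thesis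
      by (simp add: card_mono)
  qed
  finally show ?thesis
    using deg[OF assms] by simp
qed

end

text \<open>The test-vector bound and the clique count squeeze \<open>k / m\<close> between
  \<open>(1 - 5 * r) * l\<close> and \<open>(1 + r) * l\<close>. Special cliques have order between
  \<open>(1 - 5 * r) * l\<close> and \<open>l + 2\<close>, and the two ranges are compared.\<close>

lemma asymptotic_Delsarte_geometry:
  fixes r :: real
  defines "m \<equiv> \<bar>least_eig n E\<bar>"
  assumes edge: "E u v" and "\<mu> > 0" and r: "m * real \<mu> \<le> r * real l" "r \<le> 1 / 20" and "l > 0"
  shows "\<exists>\<C>. clique_geometry n E \<C> \<and>
    (\<forall>C\<in>\<C>. (1 - 20 * r) * real k / m \<le> real (card C) \<and> real (card C) \<le> (1 + 20 * r) * real k / m)"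
proof -
  have un: "u < n"
    using g edge by blast
  have m1: "m \<ge> 1" and s: "least_eig n E = - m"
    using least_eig_le_minus_one[OF G edge] by (auto simp: m_def)
  \<comment> \<open>As \<open>m\<close> and \<open>\<mu>\<close> are at least 1, each of 1,
    \<open>m\<close> and \<open>\<mu>\<close> is at most \<open>r * l\<close>; additive constants
    are absorbed this way below.\<close>
  have "m \<le> m * real \<mu>" "real \<mu> \<le> m * real \<mu>"
    using m1 \<open>\<mu> > 0\<close> by (simp_all add: mult_le_cancel_left1 mult_le_cancel_right1)
  then have mr: "m \<le> r * l" and mur: "\<mu> \<le> r * l"
    using r by linarith+
  have rl: "1 \<le> r * l"
    using m1 mr by linarith
  then have r0: "r > 0"
    using \<open>l > 0\<close> by (intro zero_less_mult_pos2[of r "real l"]) auto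
  have rl20: "r * l \<le> l / 20"
    using r(2) \<open>l > 0\<close> by (simp add: field_simps)
  have large: "2 * \<mu> + 4 < l"
    using rl20 rl mur by linarith
  have kup: "real k \<le> m * (l + m)"
    unfolding m_def using G edge by (rule degree_le_least_eig) (use deg un lam in auto)
  also have "\<dots> \<le> m * (l + r * l)"
    using mr m1 by (intro mult_left_mono) auto
  finally have kr: "real k \<le> m * ((1 + r) * l)"
    by (simp add: algebra_simps)
  have "real k * \<mu> \<le> m * ((1 + r) * l) * \<mu>"
    using kr by (intro mult_right_mono) auto
  also have "\<dots> = (m * \<mu>) * ((1 + r) * l)"
    by simp
  also have "\<dots> \<le> (r * l) * ((1 + r) * l)"
    using r r0 by (intro mult_right_mono) auto
  also have "\<dots> \<le> (r * l) * (21 / 20 * l)"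
    using r r0 by (intro mult_left_mono mult_right_mono) auto
  finally have kmu: "real k * \<mu> \<le> 21 / 20 * r * (real l)\<^sup>2"
    by (simp add: power2_eq_square)
  also have "\<dots> \<le> 21 / 20 * (1 / 20) * (real l)\<^sup>2"
    using r by (intro mult_right_mono mult_left_mono) auto
  finally have small: "16 * real k * real \<mu> \<le> (real l)\<^sup>2"
    by (simp add: field_simps) (use zero_le_power2[of "real l"] in linarith)
  \<comment> \<open>\<open>B\<close> is the shortfall of a special clique from order
    \<open>l + 2\<close>.\<close>
  define B where "B = 4 * real k * real \<mu> / real l"
  have B: "B \<le> 5 * r * l"
  proof -
    have "B \<le> 4 * (21 / 20 * r * (real l)\<^sup>2) / l"
      unfolding B_def using kmu by (intro divide_right_mono) auto
    also have "\<dots> = 21 / 5 * r * l"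
      using \<open>l > 0\<close> by (simp add: power2_eq_square)
    also have "\<dots> \<le> 5 * r * l"
      using r0 by (simp add: mult_right_mono)
    finally show ?thesis .
  qed
  have pos: "0 < real l + 1 - B"
    using B rl20 by linarith
  have "- least_eig n E \<le> k / (real l + 1 - B)"
  proof (rule least_eig_ge_clique_geometry[OF G _ clique_geometry_special_cliques[OF large small]])
    fix w assume "w < n"
    then show "real (card {C \<in> special_cliques. w \<in> C}) \<le> k / (real l + 1 - B)"
      using card_special_cliques_at_vertex[OF large small, of w] pos
      by (simp add: B_def pos_le_divide_eq)
  qed (use un in simp)
  then have "m * (real l + 1 - B) \<le> k"
    using s pos by (simp add: pos_le_divide_eq)
  moreover have "m * ((1 - 5 * r) * l) \<le> m * (real l + 1 - B)"
    using B m1 by (intro mult_left_mono) (auto simp: algebra_simps)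
  ultimately have klow: "m * ((1 - 5 * r) * l) \<le> k"
    by linarith
  have rr: "r * r \<le> r * (1 / 20)"
    using r r0 by (intro mult_left_mono) auto
  have "(1 - 20 * r) * real k / m \<le> real (card C) \<and> real (card C) \<le> (1 + 20 * r) * real k / m"
    if C: "C \<in> special_cliques" for C
  proof
    \<comment> \<open>The product \<open>(1 - 20 * r) * (1 + r)\<close> is
      \<open>1 - 19 * r - 20 * r * r\<close>, below \<open>1 - 5 * r\<close>.\<close>
    have "(1 - 20 * r) * k \<le> (1 - 20 * r) * (m * ((1 + r) * l))"
      using kr r by (intro mult_left_mono) auto
    also have "\<dots> = m * (((1 - 20 * r) * (1 + r)) * l)"
      by simp
    also have "\<dots> \<le> m * ((1 - 5 * r) * l)"
      using m1 r0 by (intro mult_left_mono mult_right_mono) (auto simp: algebra_simps)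
    finally have "(1 - 20 * r) * k / m \<le> (1 - 5 * r) * l"
      using m1 by (simp add: pos_divide_le_eq mult.commute)
    also have "\<dots> \<le> card C"
      using card_special_clique(1)[OF large small C] B by (simp add: B_def algebra_simps)
    finally show "(1 - 20 * r) * real k / m \<le> real (card C)" .
    have "m * card C \<le> m * (l + 2)"
      using card_special_clique(2)[OF large small C] m1 by (intro mult_left_mono) auto
    also have "\<dots> \<le> m * ((1 + 10 * r) * l)"
      using rl m1 by (intro mult_left_mono) (auto simp: algebra_simps)
    \<comment> \<open>The product is \<open>1 + 15 * r - 100 * r * r\<close>, which is at least
      \<open>1 + 10 * r\<close> exactly because \<open>0 < r\<close> and
      \<open>r \<le> 1 / 20\<close>.\<close>
    also have "\<dots> \<le> m * (((1 + 20 * r) * (1 - 5 * r)) * l)"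
      using m1 rr by (intro mult_left_mono mult_right_mono) (auto simp: algebra_simps)
    also have "\<dots> = (1 + 20 * r) * (m * ((1 - 5 * r) * l))"
      by simp
    also have "\<dots> \<le> (1 + 20 * r) * k"
      using klow r0 by (intro mult_left_mono) auto
    finally show "card C \<le> (1 + 20 * r) * real k / m"
      using m1 by (simp add: pos_le_divide_eq mult.commute)
  qed
  then show ?thesis
    using clique_geometry_special_cliques[OF large small] by blast
qed

end

section \<open>Distance-regular graphs\<close>

text \<open>Connectivity provides a walk, so that the \<open>LEAST\<close> in \<open>gdist\<close>
  is attained.\<close>

lemma gdist_eq_1_iff:
  assumes G: "simple_graph n E" and con: "connected_graph n E" and "u < n" "v < n"
  shows "gdist n E u v = 1 \<longleftrightarrow> E u v"
proof
  assume 1: "gdist n E u v = 1"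
  obtain d where "walk n E d u v"
    using con assms by (auto simp: connected_graph_def)
  then have "walk n E (gdist n E u v) u v"
    unfolding gdist_def by (rule LeastI)
  then show "E u v"
    unfolding 1 by simp
next
  assume "E u v"
  then have "walk n E 1 u v" "\<not> walk n E 0 u v"
    using simple_graphD[OF G] by auto
  then show "gdist n E u v = 1"
    unfolding gdist_def by (intro Least_equality) (auto simp: Suc_le_eq intro!: gr0I)
qed

lemma gdist_eq_2_iff:
  assumes G: "simple_graph n E" and con: "connected_graph n E" and uv: "u < n" "v < n"
  shows "gdist n E u v = 2 \<longleftrightarrow> u \<noteq> v \<and> \<not> E u v \<and> neighbors n E u \<inter> neighbors n E v \<noteq> {}"
proof -
  note g = simple_graphD[OF G]
  have w2: "walk n E 2 u v \<longleftrightarrow> neighbors n E u \<inter> neighbors n E v \<noteq> {}"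
    using g by (auto simp: numeral_2_eq_2 neighbors_def)
  have w1: "walk n E 1 u v \<longleftrightarrow> E u v"
    using g by auto
  show ?thesis
  proof
    assume 2: "gdist n E u v = 2"
    obtain d where "walk n E d u v"
      using con uv by (auto simp: connected_graph_def)
    then have "walk n E (gdist n E u v) u v"
      unfolding gdist_def by (rule LeastI)
    moreover have "\<not> walk n E 0 u v" "\<not> walk n E 1 u v"
      using 2 by (auto simp only: gdist_def intro!: not_less_Least[of _ "\<lambda>m. walk n E m u v"])
    ultimately show "u \<noteq> v \<and> \<not> E u v \<and> neighbors n E u \<inter> neighbors n E v \<noteq> {}"
      using 2 w1 w2 by (metis walk.simps(1))
  next
    assume R: "u \<noteq> v \<and> \<not> E u v \<and> neighbors n E u \<inter> neighbors n E v \<noteq> {}"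
    have "2 \<le> d" if "walk n E d u v" for d
    proof (rule ccontr)
      assume "\<not> 2 \<le> d"
      then have "d = 0 \<or> d = 1"
        by linarith
      then show False
        using that R w1 by auto
    qed
    then show "gdist n E u v = 2"
      unfolding gdist_def using R w2 by (intro Least_equality) auto
  qed
qed

lemma bounded_mu_graph_distance_regular:
  assumes "distance_regular n E"
  shows "bounded_mu_graph n E (drg_k n E) (drg_lambda n E) (drg_mu n E)"
proof -
  have G: "simple_graph n E" and "n > 0" and con: "connected_graph n E"
    and reg: "\<And>u v u' v' j. \<lbrakk>u < n; v < n; u' < n; v' < n; gdist n E u v = gdist n E u' v';
        j \<in> {gdist n E u v - 1, gdist n E u v, gdist n E u v + 1}\<rbrakk> \<Longrightarrow>
        card {w \<in> neighbors n E v. gdist n E u w = j} = card {w \<in> neighbors n E v'. gdist n E u' w = j}"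
    using assms unfolding distance_regular_def by blast+
  note g = simple_graphD[OF G]
  note d1 = gdist_eq_1_iff[OF G con] and d2 = gdist_eq_2_iff[OF G con]
  have sphere: "{w \<in> neighbors n E v. gdist n E u w = 1} = neighbors n E u \<inter> neighbors n E v"
    if "u < n" for u v
    using that d1 by (auto simp: neighbors_def)
  have d0: "gdist n E u u = 0" for u
    unfolding gdist_def by (rule Least_eq_0) simp
  show ?thesis
  proof
    show "simple_graph n E"
      by (rule G)
  next
    fix v assume v: "v < n"
    show "card (neighbors n E v) = drg_k n E"
      using reg[of v v 0 0 1] v \<open>n > 0\<close> sphere[OF v, of v] sphere[of 0 0] by (simp add: d0 drg_k_def)
  next
    fix u v assume uv: "E u v"
    \<comment> \<open>\<open>drg_lambda\<close> is read off one chosen edge; regularity at distance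
      1 carries the count to every edge. Below, distance 2 is treated likewise for
      \<open>drg_mu\<close>.\<close>
    define p where "p = (SOME p. E (fst p) (snd p))"
    have p: "E (fst p) (snd p)"
      unfolding p_def by (rule someI[of _ "(u, v)"]) (use uv in simp)
    have "drg_lambda n E = card (neighbors n E (fst p) \<inter> neighbors n E (snd p))"
      using uv unfolding drg_lambda_def p_def by (auto simp: case_prod_beta)
    moreover have n: "u < n" "v < n" "fst p < n" "snd p < n"
      using uv p g by blast+
    then have "gdist n E u v = 1" "gdist n E (fst p) (snd p) = 1"
      using uv p d1 by blast+
    then have "card {w \<in> neighbors n E v. gdist n E u w = 1}
        = card {w \<in> neighbors n E (snd p). gdist n E (fst p) w = 1}"
      using n by (intro reg) auto
    ultimately show "card (neighbors n E u \<inter> neighbors n E v) = drg_lambda n E"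
      using n by (simp only: sphere)
  next
    fix u v assume uv: "u < n" "v < n" "u \<noteq> v" "\<not> E u v"
    show "card (neighbors n E u \<inter> neighbors n E v) \<le> drg_mu n E"
    proof (cases "neighbors n E u \<inter> neighbors n E v = {}")
      case False
      define p where "p = (SOME p. fst p < n \<and> snd p < n \<and> gdist n E (fst p) (snd p) = 2)"
      have 2: "gdist n E u v = 2"
        using False uv d2 by simp
      have p: "fst p < n \<and> snd p < n \<and> gdist n E (fst p) (snd p) = 2"
        unfolding p_def by (rule someI[of _ "(u, v)"]) (use uv 2 in simp)
      have "drg_mu n E = card (neighbors n E (fst p) \<inter> neighbors n E (snd p))"
        using uv 2 unfolding drg_mu_def p_def by (auto simp: case_prod_beta)
      moreover have "card {w \<in> neighbors n E v. gdist n E u w = 1}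
          = card {w \<in> neighbors n E (snd p). gdist n E (fst p) w = 1}"
        using uv 2 p by (intro reg) auto
      ultimately show ?thesis
        using uv p by (simp only: sphere)
    qed simp
  qed
qed

text \<open>If \<open>drg_mu\<close> is 0, non-adjacent distinct vertices have no common neighbour.
  By induction along a walk, its start is then equal or adjacent to its end, and connectivity gives
  completeness.\<close>

lemma drg_mu_pos_or_complete:
  assumes "distance_regular n E"
  shows "drg_mu n E > 0 \<or> (\<forall>u<n. \<forall>v<n. u \<noteq> v \<longrightarrow> E u v)"
proof (rule disjCI)
  assume incomplete: "\<not> (\<forall>u<n. \<forall>v<n. u \<noteq> v \<longrightarrow> E u v)"
  interpret bounded_mu_graph n E "drg_k n E" "drg_lambda n E" "drg_mu n E"
    using assms by (rule bounded_mu_graph_distance_regular)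
  show "drg_mu n E > 0"
  proof (rule ccontr)
    assume "\<not> drg_mu n E > 0"
    then have no_common: "N u \<inter> N v = {}" if "u < n" "v < n" "u \<noteq> v" "\<not> E u v" for u v
      using mu[OF that] by simp
    have "u = v \<or> E u v" if "walk n E d u v" "u < n" "v < n" for d u v
      using that
    proof (induction d arbitrary: u)
      case (Suc d)
      then obtain w where "w < n" "E u w" "walk n E d w v"
        by auto
      then have "w = v \<or> E w v"
        using Suc by blast
      then show ?case
        using no_common[of u v] \<open>E u w\<close> Suc.prems(2,3) g(3)[of w v]
        by (metis Int_iff empty_iff in_neighbors_iff)
    qed simp
    then show False
      using assms incomplete unfolding distance_regular_def connected_graph_def by blast
  qed
qed

text \<open>One special clique at each vertex bounds the least eigenvalue below by -1, and any edge
  bounds it above by -1.\<close>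

lemma complete_graph_Delsarte_geometry:
  assumes G: "simple_graph n E" and "n \<ge> 2"
    and complete: "\<And>u v. u < n \<Longrightarrow> v < n \<Longrightarrow> u \<noteq> v \<Longrightarrow> E u v"
  shows "clique_geometry n E {{..<n}}" and "least_eig n E = - 1" and "drg_k n E = n - 1"
proof -
  note g = simple_graphD[OF G]
  have "is_clique n E {..<n}"
    using complete by (simp add: is_clique_def)
  then have "maximal_clique n E {..<n}"
    unfolding maximal_clique_def by (metis is_clique_def subset_antisym)
  moreover have "\<exists>!C. C \<in> {{..<n}} \<and> u \<in> C \<and> v \<in> C" if "E u v" for u v
    using g(1,2)[OF that] by auto
  ultimately show geo: "clique_geometry n E {{..<n}}"
    by (simp add: clique_geometry_def)
  have "- least_eig n E \<le> 1"
  proof (rule least_eig_ge_clique_geometry[OF G _ geo])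
    fix v assume "v < n"
    then have "{C \<in> {{..<n}}. v \<in> C} = {{..<n}}"
      by auto
    then show "real (card {C \<in> {{..<n}}. v \<in> C}) \<le> 1"
      by simp
  qed (use assms in simp)
  moreover have "least_eig n E \<le> - 1"
    by (rule least_eig_le_minus_one[OF G complete[of 0 1]]) (use \<open>n \<ge> 2\<close> in auto)
  ultimately show "least_eig n E = - 1"
    by simp
  have "neighbors n E 0 = {..<n} - {0}"
    using complete[of 0] g(4) \<open>n \<ge> 2\<close> by (auto simp: neighbors_def)
  then show "drg_k n E = n - 1"
    using \<open>n \<ge> 2\<close> by (simp add: drg_k_def)
qed

text \<open>The summand \<open>2 / real n\<close> of \<open>e\<close> serves the complete graphs,
  whose special clique has order \<open>n\<close> while \<open>k / m\<close> is
  \<open>n - 1\<close>.\<close>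

lemma distance_regular_Delsarte_geometry:
  fixes n E
  defines "m \<equiv> \<bar>least_eig n E\<bar>"
  defines "r \<equiv> m * real (drg_mu n E) / real (drg_lambda n E)"
  defines "e \<equiv> 20 * r + 2 / real n"
  assumes drg: "distance_regular n E" and lam_pos: "drg_lambda n E > 0" and r: "r \<le> 1 / 20"
  shows "\<exists>\<C>. clique_geometry n E \<C> \<and>
    (\<forall>C\<in>\<C>. (1 - e) * real (drg_k n E) / m \<le> real (card C) \<and>
            real (card C) \<le> (1 + e) * real (drg_k n E) / m)"
proof -
  interpret bounded_mu_graph n E "drg_k n E" "drg_lambda n E" "drg_mu n E"
    using drg by (rule bounded_mu_graph_distance_regular)
  \<comment> \<open>\<open>drg_lambda\<close> defaults to 0 on an edgeless graph, so its positivity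
    yields an edge.\<close>
  obtain u v where uv: "E u v"
    using lam_pos by (auto simp: drg_lambda_def split: if_splits)
  then have n2: "n \<ge> 2"
    using g(1,2)[OF uv] g(4)[of u] by (cases "u = v") auto
  have m1: "m \<ge> 1"
    using least_eig_le_minus_one[OF G uv] by (simp add: m_def)
  have r0: "r \<ge> 0"
    by (simp add: r_def m_def)
  from drg_mu_pos_or_complete[OF drg] show ?thesis
  proof
    assume "drg_mu n E > 0"
    have "m * real (drg_mu n E) \<le> r * real (drg_lambda n E)"
      using lam_pos by (simp add: r_def)
    then obtain \<C> where geo: "clique_geometry n E \<C>"
      and C: "\<And>C. C \<in> \<C> \<Longrightarrow> (1 - 20 * r) * real (drg_k n E) / m \<le> real (card C) \<and>
            real (card C) \<le> (1 + 20 * r) * real (drg_k n E) / m"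
      using asymptotic_Delsarte_geometry[OF uv \<open>drg_mu n E > 0\<close> _ r lam_pos] unfolding m_def by blast
    have "(1 - e) * real (drg_k n E) / m \<le> (1 - 20 * r) * real (drg_k n E) / m"
      "(1 + 20 * r) * real (drg_k n E) / m \<le> (1 + e) * real (drg_k n E) / m"
      using m1 by (auto simp: e_def intro!: divide_right_mono mult_right_mono)
    then show ?thesis
      using geo C by (intro exI[of _ \<C>]) (meson order_trans)
  next
    assume "\<forall>u<n. \<forall>v<n. u \<noteq> v \<longrightarrow> E u v"
    then have c: "clique_geometry n E {{..<n}}" "least_eig n E = - 1" "drg_k n E = n - 1"
      using complete_graph_Delsarte_geometry[OF G n2] by blast+
    have e: "2 / n \<le> e"
      using r0 by (simp add: e_def)
    have "(1 - e) * real (n - 1) \<le> 1 * real (n - 1)"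
      using e order_trans[OF _ e, of 0] by (intro mult_right_mono) auto
    also have "\<dots> \<le> real n"
      by simp
    finally have "(1 - e) * real (n - 1) \<le> real n" .
    \<comment> \<open>The right side equals \<open>n + 1 - 2 / n\<close>, which is at least
      \<open>n\<close> once \<open>n\<close> is at least 2.\<close>
    moreover have "real n \<le> (1 + 2 / n) * real (n - 1)"
      using n2 by (simp add: field_simps of_nat_diff)
    then have "real n \<le> (1 + e) * real (n - 1)"
      using e by (smt (verit) mult_right_mono of_nat_0_le_iff)
    ultimately show ?thesis
      using c by (intro exI[of _ "{{..<n}}"]) (simp add: m_def)
  qed
qed

theorem theorem9:
  fixes n :: "nat \<Rightarrow> nat" and E :: "nat \<Rightarrow> nat \<Rightarrow> nat \<Rightarrow> bool"
  assumes drg: "\<And>i. distance_regular (n i) (E i)"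
    and n_inf: "filterlim n at_top sequentially"
    and lam_pos: "eventually (\<lambda>i. drg_lambda (n i) (E i) > 0) sequentially"
    and ratio: "(\<lambda>i. \<bar>least_eig (n i) (E i)\<bar> * real (drg_mu (n i) (E i)) / real (drg_lambda (n i) (E i)))
                 \<longlonglongrightarrow> 0"
  shows "\<exists>\<epsilon> :: nat \<Rightarrow> real. \<epsilon> \<longlonglongrightarrow> 0 \<and>
           eventually (\<lambda>i. \<exists>\<C>. clique_geometry (n i) (E i) \<C> \<and>
             (\<forall>C\<in>\<C>.
                (1 - \<epsilon> i) * real (drg_k (n i) (E i)) / \<bar>least_eig (n i) (E i)\<bar> \<le> real (card C) \<and>
                real (card C) \<le> (1 + \<epsilon> i) * real (drg_k (n i) (E i)) / \<bar>least_eig (n i) (E i)\<bar>))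
             sequentially"
proof -
  define r where "r i = \<bar>least_eig (n i) (E i)\<bar> * real (drg_mu (n i) (E i)) / real (drg_lambda (n i) (E i))" for i
  have r: "r \<longlonglongrightarrow> 0"
    using ratio by (simp add: r_def[abs_def])
  \<comment> \<open>The growth of \<open>n\<close> removes the error term coming from complete
    graphs.\<close>
  have "(\<lambda>i. 2 / real (n i)) \<longlonglongrightarrow> 0"
    using n_inf by (intro tendsto_divide_0[OF tendsto_const] filterlim_at_top_imp_at_infinity
        filterlim_compose[OF filterlim_real_sequentially])
  then have "(\<lambda>i. 20 * r i + 2 / real (n i)) \<longlonglongrightarrow> 20 * 0 + 0"
    using r by (intro tendsto_intros)
  moreover have "eventually (\<lambda>i. r i < 1 / 20) sequentially"
    using r by (rule order_tendstoD) simp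
  then have "eventually (\<lambda>i. \<exists>\<C>. clique_geometry (n i) (E i) \<C> \<and>
      (\<forall>C\<in>\<C>.
        (1 - (20 * r i + 2 / real (n i))) * real (drg_k (n i) (E i)) / \<bar>least_eig (n i) (E i)\<bar> \<le> real (card C) \<and>
        real (card C) \<le> (1 + (20 * r i + 2 / real (n i))) * real (drg_k (n i) (E i)) / \<bar>least_eig (n i) (E i)\<bar>))
      sequentially"
    using lam_pos
    by eventually_elim (use distance_regular_Delsarte_geometry drg in \<open>simp add: r_def\<close>)
  ultimately show ?thesis
    by (intro exI[of _ "\<lambda>i. 20 * r i + 2 / real (n i)"]) simp
qed

end
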